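(* Assume $\mathrm{cost}(\cdot,\cdot)$ is $\beta$-smooth, let $\eta^{\mathrm{shift}}\in[0,1)$ and let $t_\lambda\ge0$ be arbitrary. Let $\hat S$, with speeds $\hat s_j$, be an optimal schedule for $\hat{\mathcal{J}}^{\mathrm{up}}$, and let $S^{\mathrm{shift}}$ be the schedule for $\mathcal{J}^{\mathrm{shift}}_{\ge t_\lambda}$ which, for all $t\ge t_\lambda$ and every $(j,r_j,p_j,v_j)\in\mathcal{J}^{\mathrm{shift}}_{\ge t_\lambda}$, processes $j$ at speed $s_j(t)=\hat s_j(t-\bar\eta)$ (the job of $\hat{\mathcal{J}}^{\mathrm{up}}$ with the same identifier). Then $$\mathrm{cost}(S^{\mathrm{shift}},\mathcal{J}^{\mathrm{shift}}_{\ge t_\lambda})\le\big(1+2\eta^{\mathrm{shift}}(1+\eta^{\mathrm{shift}})\big)\mathtt{OPT}(\hat{\mathcal{J}}).$$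
   Context: Jobs are tuples $(j,r_j,p_j,v_j)$ (identifier, release time, processing time, weight $v_j>0$). A feasible schedule assigns speeds $s_j(t)\ge0$ (zero before $r_j$); energy $E(S)=\int(\sum_js_j(t))^\alpha dt$, $\alpha>1$; work profile $w^S_j(t)=p_j-\int_{r_j}^ts_j$; the quality cost $F(S,\mathcal{J})$ depends only on work profiles and parameters of jobs in $\mathcal{J}$ and is subadditive and monotone (pointwise smaller work profiles give smaller $F$); $\mathrm{cost}=E+F$; $\mathtt{OPT}$ is the optimal cost. $\mathcal{J}_{\ge t}$ = jobs with (true) release time $\ge t$. Smoothness: a function $\beta$ from job sets to $\mathbb{R}$ is smooth if $\beta(\mathcal{J}')\le(1+\max_j\eta_j)\beta(\mathcal{J})$ whenever $\mathcal{J}'=\{(j,r'_j,p_j(1+\eta_j),v_j(1+\eta_j))\}$ with $r'_j,\eta_j\ge0$, and monotone if $\beta(\mathcal{J}'')\le\beta(\mathcal{J})$ for $\mathcal{J}''\subseteq\mathcal{J}$. The cost is $\beta$-smooth if $\beta\ge1$ is smooth and monotone and for all $\eta,\eta'\in[0,1]$, $\mathcal{J}_1,\mathcal{J}_2$ with a bijection $\pi:\mathcal{J}_1\to\mathcal{J}_2$, and feasible $S_1,S_2$: (i) if $|r_j-r_{\pi(j)}|\le\eta'$, $p_j\le p_{\pi(j)}(1+\eta)$, $v_j\le v_{\pi(j)}(1+\eta)$ for all $j$, then $\mathtt{OPT}(\mathcal{J}_1)\le(1+\beta(\mathcal{J}_1)\eta)\mathtt{OPT}(\mathcal{J}_2)+\beta(\mathcal{J}_1)|\mathcal{J}_1|\eta'$;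 (ii) if $p_j\le p_{\pi(j)}$, $v_j\le v_{\pi(j)}$, $r_j\ge r_{\pi(j)}-\eta'$, and $w^{S_1}_j(t)\le w^{S_2}_{\pi(j)}(t-\eta')$ for all $t\ge r_{\pi(j)}+\eta'$, for all $j$, then $F(S_1,\mathcal{J}_1)\le F(S_2,\mathcal{J}_2)+\beta(\mathcal{J}_1)|\mathcal{J}_1|\eta'$. Shifted predictions: true jobs $\mathcal{J}$ and predicted jobs $\hat{\mathcal{J}}=\{(j,\hat r_j,\hat p_j,\hat v_j)\}$ (nonempty, $\mathtt{OPT}(\hat{\mathcal{J}})>0$); a true job is matched with the predicted job of the same identifier if any. Let $\bar\eta=\frac{\eta^{\mathrm{shift}}}{\beta(\hat{\mathcal{J}})}\cdot\frac{\mathtt{OPT}(\hat{\mathcal{J}})}{|\hat{\mathcal{J}}|}$. $\mathcal{J}^{\mathrm{shift}}$ is the set of true jobs $(j,r_j,p_j,v_j)$ having a predicted counterpart with $|r_j-\hat r_j|\le\bar\eta$, $|p_j-\hat p_j|\le\frac{\eta^{\mathrm{shift}}}{\beta(\hat{\mathcal{J}})}\hat p_j$ and $|v_j-\hat v_j|\le\frac{\eta^{\mathrm{shift}}}{\beta(\hat{\mathcal{J}})}\hat v_j$. $\hat{\mathcal{J}}^{\mathrm{up}}=\{(j,\hat r_j,\hat p_j(1+\frac{\eta^{\mathrm{shift}}}{\beta(\hat{\mathcal{J}})}),\hat v_j(1+\frac{\eta^{\mathrm{shift}}}{\beta(\hat{\mathcal{J}})})):(j,\hat r_j,\hat p_j,\hat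 v_j)\in\hat{\mathcal{J}}\}$.
   Formalization: The quality cost F is also monotone under inclusion of job sets: $F(S,\mathcal{J}')\le F(S,\mathcal{J})$ for every feasible schedule S of $\mathcal{J}$ and every $\mathcal{J}'\subseteq\mathcal{J}$. The statement above fails without it. *)

theory Defs
  imports "HOL-Analysis.Analysis"
begin

text \<open>A job is a tuple (identifier, release time, processing time, weight).
  A job set is a set of such tuples; a schedule assigns to every identifier a speed function.\<close>

type_synonym 'i job = "'i \<times> real \<times> real \<times> real"
type_synonym 'i schedule = "'i \<Rightarrow> real \<Rightarrow> real"

definition jid :: "'i job \<Rightarrow> 'i" where "jid x = fst x"
definition rel :: "'i job \<Rightarrow> real" where "rel x = fst (snd x)"
definition proc :: "'i job \<Rightarrow> real" where "proc x = fst (snd (snd x))"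
definition wt :: "'i job \<Rightarrow> real" where "wt x = snd (snd (snd x))"

definition valid_jobs :: "'i job set \<Rightarrow> bool" where
  "valid_jobs J \<longleftrightarrow> finite J \<and> inj_on jid J \<and>
     (\<forall>x\<in>J. rel x \<ge> 0 \<and> proc x > 0 \<and> wt x > 0)"

definition energy :: "real \<Rightarrow> 'i schedule \<Rightarrow> 'i job set \<Rightarrow> real" where
  "energy \<alpha> S J = (\<integral>t. (\<Sum>x\<in>J. S (jid x) t) powr \<alpha> \<partial>lborel)"

definition work :: "'i schedule \<Rightarrow> 'i job \<Rightarrow> real \<Rightarrow> real" where
  "work S x t = proc x - (LBINT u=rel x..t. S (jid x) u)"

definition feasible :: "real \<Rightarrow> 'i job set \<Rightarrow> 'i schedule \<Rightarrow> bool" where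
  "feasible \<alpha> J S \<longleftrightarrow>
     (\<forall>x\<in>J. (\<forall>t. S (jid x) t \<ge> 0) \<and> (\<forall>t. t < rel x \<longrightarrow> S (jid x) t = 0) \<and>
            S (jid x) \<in> borel_measurable lborel \<and>
            (\<forall>a b. set_integrable lborel {a..b} (S (jid x)))) \<and>
     integrable lborel (\<lambda>t. (\<Sum>x\<in>J. S (jid x) t) powr \<alpha>)"

definition cost :: "real \<Rightarrow> ('i schedule \<Rightarrow> 'i job set \<Rightarrow> real) \<Rightarrow> 'i schedule \<Rightarrow> 'i job set \<Rightarrow> real" where
  "cost \<alpha> F S J = energy \<alpha> S J + F S J"

definition OPT :: "real \<Rightarrow> ('i schedule \<Rightarrow> 'i job set \<Rightarrow> real) \<Rightarrow> 'i job set \<Rightarrow> real" where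
  "OPT \<alpha> F J = Inf {cost \<alpha> F S J | S. feasible \<alpha> J S}"

definition quality_cost :: "real \<Rightarrow> ('i schedule \<Rightarrow> 'i job set \<Rightarrow> real) \<Rightarrow> bool" where
  "quality_cost \<alpha> F \<longleftrightarrow>
     \<comment> \<open>depends only on work profiles and parameters of the jobs in J\<close>
     (\<forall>J S1 S2. valid_jobs J \<longrightarrow> feasible \<alpha> J S1 \<longrightarrow> feasible \<alpha> J S2 \<longrightarrow>
        (\<forall>x\<in>J. \<forall>t. work S1 x t = work S2 x t) \<longrightarrow> F S1 J = F S2 J) \<and>
     \<comment> \<open>subadditive\<close>
     (\<forall>A B S. valid_jobs (A \<union> B) \<longrightarrow> A \<inter> B = {} \<longrightarrow> feasible \<alpha> (A \<union> B) S \<longrightarrow>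
        F S (A \<union> B) \<le> F S A + F S B) \<and>
     \<comment> \<open>monotone in the work profiles\<close>
     (\<forall>J S1 S2. valid_jobs J \<longrightarrow> feasible \<alpha> J S1 \<longrightarrow> feasible \<alpha> J S2 \<longrightarrow>
        (\<forall>x\<in>J. \<forall>t. work S1 x t \<le> work S2 x t) \<longrightarrow> F S1 J \<le> F S2 J) \<and>
     \<comment> \<open>monotone in the job set (see NOTES.md)\<close>
     (\<forall>J J' S. valid_jobs J \<longrightarrow> J' \<subseteq> J \<longrightarrow> feasible \<alpha> J S \<longrightarrow> F S J' \<le> F S J)"

definition perturb :: "('i \<Rightarrow> real) \<Rightarrow> ('i \<Rightarrow> real) \<Rightarrow> 'i job set \<Rightarrow> 'i job set" where
  "perturb r' \<eta> J = (\<lambda>x. (jid x, r' (jid x), proc x * (1 + \<eta> (jid x)), wt x * (1 + \<eta> (jid x)))) ` J"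

definition smooth_fun :: "('i job set \<Rightarrow> real) \<Rightarrow> bool" where
  "smooth_fun \<beta> \<longleftrightarrow>
     (\<forall>J r' \<eta>. valid_jobs J \<longrightarrow> J \<noteq> {} \<longrightarrow> (\<forall>x\<in>J. r' (jid x) \<ge> 0 \<and> \<eta> (jid x) \<ge> 0) \<longrightarrow>
        \<beta> (perturb r' \<eta> J) \<le> (1 + Max ((\<lambda>x. \<eta> (jid x)) ` J)) * \<beta> J)"

definition monotone_fun :: "('i job set \<Rightarrow> real) \<Rightarrow> bool" where
  "monotone_fun \<beta> \<longleftrightarrow> (\<forall>J J''. valid_jobs J \<longrightarrow> J'' \<subseteq> J \<longrightarrow> \<beta> J'' \<le> \<beta> J)"

definition beta_smooth :: "real \<Rightarrow> ('i schedule \<Rightarrow> 'i job set \<Rightarrow> real) \<Rightarrow> ('i job set \<Rightarrow> real) \<Rightarrow> bool" where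
  "beta_smooth \<alpha> F \<beta> \<longleftrightarrow>
     (\<forall>J. valid_jobs J \<longrightarrow> \<beta> J \<ge> 1) \<and> smooth_fun \<beta> \<and> monotone_fun \<beta> \<and>
     (\<forall>\<eta> \<eta>' J1 J2 \<pi>. 0 \<le> \<eta> \<longrightarrow> \<eta> \<le> 1 \<longrightarrow> 0 \<le> \<eta>' \<longrightarrow> \<eta>' \<le> 1 \<longrightarrow>
        valid_jobs J1 \<longrightarrow> valid_jobs J2 \<longrightarrow> bij_betw \<pi> J1 J2 \<longrightarrow>
        ((\<forall>x\<in>J1. \<bar>rel x - rel (\<pi> x)\<bar> \<le> \<eta>' \<and> proc x \<le> proc (\<pi> x) * (1 + \<eta>) \<and>
                  wt x \<le> wt (\<pi> x) * (1 + \<eta>)) \<longrightarrow>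
          OPT \<alpha> F J1 \<le> (1 + \<beta> J1 * \<eta>) * OPT \<alpha> F J2 + \<beta> J1 * real (card J1) * \<eta>') \<and>
        (\<forall>S1 S2. feasible \<alpha> J1 S1 \<longrightarrow> feasible \<alpha> J2 S2 \<longrightarrow>
          (\<forall>x\<in>J1. proc x \<le> proc (\<pi> x) \<and> wt x \<le> wt (\<pi> x) \<and> rel x \<ge> rel (\<pi> x) - \<eta>' \<and>
                  (\<forall>t. t \<ge> rel (\<pi> x) + \<eta>' \<longrightarrow> work S1 x t \<le> work S2 (\<pi> x) (t - \<eta>'))) \<longrightarrow>
          F S1 J1 \<le> F S2 J2 + \<beta> J1 * real (card J1) * \<eta>'))"

definition released_from :: "real \<Rightarrow> 'i job set \<Rightarrow> 'i job set" where
  "released_from t J = {x \<in> J. rel x \<ge> t}"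

definition eta_bar :: "real \<Rightarrow> ('i schedule \<Rightarrow> 'i job set \<Rightarrow> real) \<Rightarrow> ('i job set \<Rightarrow> real) \<Rightarrow> real \<Rightarrow> 'i job set \<Rightarrow> real" where
  "eta_bar \<alpha> F \<beta> \<eta>s Jh = \<eta>s / \<beta> Jh * (OPT \<alpha> F Jh / real (card Jh))"

definition J_shift :: "real \<Rightarrow> ('i schedule \<Rightarrow> 'i job set \<Rightarrow> real) \<Rightarrow> ('i job set \<Rightarrow> real) \<Rightarrow> real \<Rightarrow> 'i job set \<Rightarrow> 'i job set \<Rightarrow> 'i job set" where
  "J_shift \<alpha> F \<beta> \<eta>s J Jh = {x \<in> J. \<exists>y\<in>Jh. jid y = jid x \<and>
      \<bar>rel x - rel y\<bar> \<le> eta_bar \<alpha> F \<beta> \<eta>s Jh \<and>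
      \<bar>proc x - proc y\<bar> \<le> \<eta>s / \<beta> Jh * proc y \<and>
      \<bar>wt x - wt y\<bar> \<le> \<eta>s / \<beta> Jh * wt y}"

definition J_up :: "('i job set \<Rightarrow> real) \<Rightarrow> real \<Rightarrow> 'i job set \<Rightarrow> 'i job set" where
  "J_up \<beta> \<eta>s Jh = (\<lambda>x. (jid x, rel x, proc x * (1 + \<eta>s / \<beta> Jh), wt x * (1 + \<eta>s / \<beta> Jh))) ` Jh"

end

theory Submission
  imports Defs
begin

text \<open>Write \<open>\<eta> = \<eta>s / \<beta> Jh\<close>. Every job of the shifted set has a partner in \<open>J_up\<close> with
  release time within \<open>eta_bar\<close> and larger size and weight. Moved to the release times of
  their jobs, the partners receive at least the work of the truncated schedule, so by clause (ii)
  of \<open>\<beta>\<close>-smoothness their quality cost is no smaller; moving the releases back costs at most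
  \<open>\<beta> (J_up \<beta> \<eta>s Jh) * card * eta_bar\<close>, again by clause (ii), and the energy can only
  decrease since all speeds are dominated by the delayed ones. Finally clause (i) gives
  \<open>OPT (J_up) \<le> (1 + \<beta> (J_up) * \<eta>) * OPT Jh\<close>, smoothness of \<open>\<beta>\<close> gives
  \<open>\<beta> (J_up) * \<eta> \<le> (1 + \<eta>) * \<eta>s\<close>, and \<open>card * eta_bar \<le> \<eta> * OPT Jh\<close> as at most \<open>card Jh\<close>
  jobs are shifted.\<close>

lemma job_simps [simp]:
  "jid (i, r, p, v) = i" "rel (i, r, p, v) = r" "proc (i, r, p, v) = p" "wt (i, r, p, v) = v"
  by (simp_all add: jid_def rel_def proc_def wt_def)

lemma job_collapse: "(jid x, rel x, proc x, wt x) = x"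
  by (simp add: jid_def rel_def proc_def wt_def)

definition delay :: "real \<Rightarrow> 'i schedule \<Rightarrow> 'i schedule" where
  "delay c S = (\<lambda>j t. S j (t - c))"

definition job_with_id :: "'i job set \<Rightarrow> 'i \<Rightarrow> 'i job" where
  "job_with_id K i = (THE x. x \<in> K \<and> jid x = i)"

lemma job_with_id_eq:
  assumes "inj_on jid K" and "x \<in> K"
  shows "job_with_id K (jid x) = x"
  unfolding job_with_id_def by (rule the_equality) (use assms in \<open>auto dest: inj_onD\<close>)

lemma job_with_id_partner:
  assumes "inj_on jid K" and "\<exists>y\<in>K. jid y = jid x \<and> P y"
  shows "job_with_id K (jid x) \<in> K \<and> jid (job_with_id K (jid x)) = jid x \<and> P (job_with_id K (jid x))"
proof -
  obtain y where "y \<in> K" "jid y = jid x" "P y" using assms(2) by blast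
  moreover from this have "job_with_id K (jid x) = y" using job_with_id_eq[OF assms(1)] by metis
  ultimately show ?thesis by simp
qed

lemma
  assumes "feasible \<alpha> J S" and "x \<in> J"
  shows feasible_speed_nonneg: "0 \<le> S (jid x) t"
    and feasible_speed_before_release: "t < rel x \<Longrightarrow> S (jid x) t = 0"
    and feasible_speed_measurable: "S (jid x) \<in> borel_measurable borel"
  using assms by (simp_all add: feasible_def)

lemma interpolation_bounds:
  fixes a b c :: real and k n :: nat
  assumes "0 \<le> a" "0 \<le> b" "\<bar>b - a\<bar> \<le> c" "0 < n"
  shows "k \<le> n \<Longrightarrow> 0 \<le> a + real k / n * (b - a)"
    and "k \<le> n \<Longrightarrow> a + real k / n * (b - a) \<le> a + real k * (c / n)"
    and "a + real k / n * (b - a) - c / n \<le> a + real (Suc k) / n * (b - a)"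
proof -
  assume "k \<le> n"
  then have \<theta>: "0 \<le> real k / n" "real k / n \<le> 1" using assms(4) by (auto simp: divide_le_eq)
  have "a + real k / n * (b - a) = (1 - real k / n) * a + real k / n * b"
    by (simp add: algebra_simps diff_divide_distrib)
  then show "0 \<le> a + real k / n * (b - a)"
    using \<theta> assms(1,2) by simp
  show "a + real k / n * (b - a) \<le> a + real k * (c / n)"
    using mult_left_mono[of "b - a" c "real k / n"] \<theta> assms(3) by simp
next
  have "- c / n \<le> (b - a) / n" using assms(3,4) by (intro divide_right_mono) auto
  then show "a + real k / n * (b - a) - c / n \<le> a + real (Suc k) / n * (b - a)"
    by (simp add: add_divide_distrib algebra_simps)
qed

lemma interval_lebesgue_integral_shift:
  fixes f :: "real \<Rightarrow> real"
  shows "(LBINT u=ereal a..ereal b. f (u - c)) = (LBINT u=ereal (a - c)..ereal (b - c). f u)"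
proof -
  have "(\<integral>x. indicator {d - c<..<e - c} x *\<^sub>R f x \<partial>lborel) =
        (\<integral>x. indicator {d<..<e} x *\<^sub>R f (x - c) \<partial>lborel)" for d e :: real
    using lborel_integral_real_affine[of 1 "\<lambda>x. indicator {d - c<..<e - c} x *\<^sub>R f x" "-c"]
    by (simp add: indicator_def algebra_simps)
  then show ?thesis
    unfolding interval_lebesgue_integral_def set_lebesgue_integral_def by simp
qed

lemma interval_lebesgue_integral_vanishing_below:
  fixes f :: "real \<Rightarrow> real"
  assumes vanish: "\<And>u. u < c \<Longrightarrow> f u = 0" and "a \<le> c"
  shows "(LBINT u=ereal a..ereal b. f u) = (LBINT u=ereal c..ereal b. f u)"
proof (cases "c \<le> b")
  case True
  have "(\<integral>x. indicator {a<..<b} x *\<^sub>R f x \<partial>lborel) = (\<integral>x. indicator {c<..<b} x *\<^sub>R f x \<partial>lborel)"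
    by (rule integral_discrete_difference[of "{c}"])
       (use vanish \<open>a \<le> c\<close> True in \<open>auto simp: indicator_def\<close>)
  then show ?thesis using True \<open>a \<le> c\<close>
    unfolding interval_lebesgue_integral_def set_lebesgue_integral_def by simp
next
  case False
  have "(\<integral>x. indicator {d<..<e} x *\<^sub>R f x \<partial>lborel) = 0" if "e \<le> c" for d e
    by (rule integral_eq_zero_AE) (use vanish that in \<open>auto simp: indicator_def\<close>)
  then show ?thesis using False \<open>a \<le> c\<close>
    unfolding interval_lebesgue_integral_def set_lebesgue_integral_def by simp
qed

lemma work_delay:
  assumes "\<And>u. u < a \<Longrightarrow> S j u = 0" and "r \<le> a + c"
  shows "work (delay c S) (j, r, p, v) t = p - (LBINT u=ereal a..ereal (t - c). S j u)"
proof -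
  have "(LBINT u=ereal r..ereal t. S j (u - c)) = (LBINT u=ereal (r - c)..ereal (t - c). S j u)"
    by (rule interval_lebesgue_integral_shift)
  also have "\<dots> = (LBINT u=ereal a..ereal (t - c). S j u)"
    by (rule interval_lebesgue_integral_vanishing_below) (use assms in auto)
  finally show ?thesis by (simp add: work_def delay_def)
qed

lemma
  fixes S Sh :: "'i schedule"
  assumes feasible: "feasible \<alpha> JU Sh" and valid: "valid_jobs JU" "valid_jobs K"
    and ids: "jid ` K \<subseteq> jid ` JU" and \<alpha>: "0 \<le> \<alpha>"
    and measurable: "\<forall>x\<in>K. S (jid x) \<in> borel_measurable lborel"
    and dominated: "\<forall>x\<in>K. \<forall>t. 0 \<le> S (jid x) t \<and> S (jid x) t \<le> delay c Sh (jid x) t"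
  shows integrable_energy_dominated: "integrable lborel (\<lambda>t. (\<Sum>x\<in>K. S (jid x) t) powr \<alpha>)"
    and energy_le_dominated: "energy \<alpha> S K \<le> energy \<alpha> Sh JU"
proof -
  define h where "h = (\<lambda>t. (\<Sum>y\<in>JU. Sh (jid y) t) powr \<alpha>)"
  have "integrable lborel h" using feasible by (simp add: feasible_def h_def)
  then have h_delay: "integrable lborel (\<lambda>t. h (t - c))"
    using lborel_integrable_real_affine[of h 1 "-c"] by simp
  have "(\<lambda>t. \<Sum>x\<in>K. S (jid x) t) \<in> borel_measurable lborel"
    using measurable by (intro borel_measurable_sum) auto
  then have measurable_power: "(\<lambda>t. (\<Sum>x\<in>K. S (jid x) t) powr \<alpha>) \<in> borel_measurable lborel"
    by measurable
  have bound: "0 \<le> (\<Sum>x\<in>K. S (jid x) t) powr \<alpha> \<and> (\<Sum>x\<in>K. S (jid x) t) powr \<alpha> \<le> h (t - c)" for t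
  proof -
    have "(\<Sum>x\<in>K. S (jid x) t) \<le> (\<Sum>i\<in>jid ` K. Sh i (t - c))"
      using dominated valid(2) by (auto simp: sum.reindex valid_jobs_def delay_def intro: sum_mono)
    also have "\<dots> \<le> (\<Sum>i\<in>jid ` JU. Sh i (t - c))"
      using feasible valid(1) ids by (intro sum_mono2) (auto simp: valid_jobs_def feasible_def)
    also have "\<dots> = (\<Sum>y\<in>JU. Sh (jid y) (t - c))"
      using valid(1) by (simp add: sum.reindex valid_jobs_def)
    finally show ?thesis
      using dominated \<alpha> by (auto simp: h_def intro!: powr_mono2 sum_nonneg)
  qed
  show integrable: "integrable lborel (\<lambda>t. (\<Sum>x\<in>K. S (jid x) t) powr \<alpha>)"
    by (rule Bochner_Integration.integrable_bound[OF h_delay measurable_power])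
       (use bound in \<open>auto intro!: AE_I2 intro: order_trans[OF _ abs_ge_self]\<close>)
  have "energy \<alpha> S K \<le> (\<integral>t. h (t - c) \<partial>lborel)"
    unfolding energy_def using bound by (intro integral_mono[OF integrable h_delay]) auto
  also have "\<dots> = energy \<alpha> Sh JU"
    using lborel_integral_real_affine[of 1 h "-c"] by (simp add: energy_def h_def)
  finally show "energy \<alpha> S K \<le> energy \<alpha> Sh JU" .
qed

lemma feasible_dominated:
  fixes S Sh :: "'i schedule"
  assumes feasible: "feasible \<alpha> JU Sh" and valid: "valid_jobs JU" "valid_jobs K"
    and ids: "jid ` K \<subseteq> jid ` JU" and \<alpha>: "0 \<le> \<alpha>"
    and measurable: "\<forall>x\<in>K. S (jid x) \<in> borel_measurable lborel"
    and dominated: "\<forall>x\<in>K. \<forall>t. 0 \<le> S (jid x) t \<and> S (jid x) t \<le> delay c Sh (jid x) t"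
    and released: "\<forall>x\<in>K. \<forall>t. t < rel x \<longrightarrow> S (jid x) t = 0"
  shows "feasible \<alpha> K S"
proof -
  have integrable: "set_integrable lborel {a..b} (S (jid x))" if x: "x \<in> K" for x a b
  proof -
    obtain y where y: "y \<in> JU" "jid y = jid x" using ids x by force
    then have "integrable lborel (\<lambda>t. indicator {a - c..b - c} t *\<^sub>R Sh (jid x) t)"
      using feasible by (auto simp: feasible_def set_integrable_def)
    then have delayed: "integrable lborel (\<lambda>t. indicator {a - c..b - c} (t - c) *\<^sub>R Sh (jid x) (t - c))"
      using lborel_integrable_real_affine[of _ 1 "-c"] by simp
    have [measurable]: "S (jid x) \<in> borel_measurable borel"
      using measurable x by (simp add: measurable_lborel1)
    have measurable_indicator: "(\<lambda>t. indicator {a..b} t *\<^sub>R S (jid x) t) \<in> borel_measurable lborel"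
      by measurable
    have bound: "norm (indicator {a..b} t *\<^sub>R S (jid x) t)
        \<le> norm (indicator {a - c..b - c} (t - c) *\<^sub>R Sh (jid x) (t - c))" for t
    proof -
      have "\<bar>S (jid x) t\<bar> \<le> \<bar>Sh (jid x) (t - c)\<bar>"
        using dominated[rule_format, OF x, of t] by (simp add: delay_def)
      then show ?thesis by (simp add: indicator_def)
    qed
    show ?thesis unfolding set_integrable_def
      by (rule Bochner_Integration.integrable_bound[OF delayed measurable_indicator AE_I2[OF bound]])
  qed
  have "\<forall>x\<in>K. (\<forall>t. 0 \<le> S (jid x) t) \<and> (\<forall>t. t < rel x \<longrightarrow> S (jid x) t = 0) \<and>
      S (jid x) \<in> borel_measurable lborel \<and> (\<forall>a b. set_integrable lborel {a..b} (S (jid x)))"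
    using dominated released measurable integrable by blast
  then show ?thesis
    unfolding feasible_def using integrable_energy_dominated[OF assms(1-7)] by (intro conjI)
qed

lemma valid_jobs_subset: "valid_jobs J \<Longrightarrow> K \<subseteq> J \<Longrightarrow> valid_jobs K"
  by (auto simp: valid_jobs_def intro: finite_subset inj_on_subset)

lemma feasible_subset:
  assumes "feasible \<alpha> J S" and "valid_jobs J" and "K \<subseteq> J" and "0 \<le> \<alpha>"
  shows "feasible \<alpha> K S"
proof (rule feasible_dominated[OF assms(1,2) valid_jobs_subset[OF assms(2,3)] _ assms(4), where c = 0])
  show "\<forall>x\<in>K. \<forall>t. 0 \<le> S (jid x) t \<and> S (jid x) t \<le> delay 0 S (jid x) t"
    using feasible_speed_nonneg[OF assms(1)] assms(3) by (auto simp: delay_def)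
  show "\<forall>x\<in>K. \<forall>t<rel x. S (jid x) t = 0"
    using feasible_speed_before_release[OF assms(1)] assms(3) by blast
  show "\<forall>x\<in>K. S (jid x) \<in> borel_measurable lborel"
    using feasible_speed_measurable[OF assms(1)] assms(3) by auto
qed (use assms(3) in auto)

lemma jid_perturb [simp]: "jid ` perturb r' \<eta> K = jid ` K"
  by (simp add: perturb_def image_image)

lemma valid_jobs_perturb:
  assumes "valid_jobs K" and "\<forall>x\<in>K. 0 \<le> r' (jid x) \<and> 0 \<le> \<eta> (jid x)"
  shows "valid_jobs (perturb r' \<eta> K)"
  unfolding valid_jobs_def
proof (intro conjI ballI)
  show "inj_on jid (perturb r' \<eta> K)"
    unfolding perturb_def by (rule inj_on_imageI) (use assms(1) in \<open>simp add: comp_def valid_jobs_def\<close>)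
  show "finite (perturb r' \<eta> K)" using assms(1) by (simp add: valid_jobs_def perturb_def)
  fix y assume "y \<in> perturb r' \<eta> K"
  then obtain x where "x \<in> K" "y = (jid x, r' (jid x), proc x * (1 + \<eta> (jid x)), wt x * (1 + \<eta> (jid x)))"
    by (auto simp: perturb_def)
  then show "0 \<le> rel y" "0 < proc y" "0 < wt y"
    using assms by (auto simp: valid_jobs_def add_pos_nonneg)
qed

lemma card_perturb:
  assumes "inj_on jid K"
  shows "card (perturb r' \<eta> K) = card K"
  unfolding perturb_def using assms by (intro card_image) (auto simp: inj_on_def)

lemma perturb_release_self:
  assumes "inj_on jid K"
  shows "perturb (\<lambda>i. rel (job_with_id K i)) (\<lambda>_. 0) K = K"
  using assms by (simp add: perturb_def job_with_id_eq job_collapse)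

lemma beta_perturb_release_le:
  assumes "smooth_fun \<beta>" and "valid_jobs K" and "\<forall>x\<in>K. 0 \<le> \<rho> (jid x)"
  shows "\<beta> (perturb \<rho> (\<lambda>_. 0) K) \<le> \<beta> K"
proof (cases "K = {}")
  case False
  then have "(\<lambda>x. 0::real) ` K = {0}" by auto
  with assms(1)[unfolded smooth_fun_def, rule_format, of K \<rho> "\<lambda>_. 0"] assms(2,3) False
  show ?thesis by simp
qed (simp add: perturb_def)

lemma beta_smooth_ge_1:
  assumes "beta_smooth \<alpha> F \<beta>" and "valid_jobs J"
  shows "1 \<le> \<beta> J"
  using assms by (simp add: beta_smooth_def)

lemma beta_smooth_imp_smooth_fun: "beta_smooth \<alpha> F \<beta> \<Longrightarrow> smooth_fun \<beta>"
  by (simp add: beta_smooth_def)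

lemma beta_smooth_OPT_le:
  assumes "beta_smooth \<alpha> F \<beta>" and "0 \<le> \<eta>" "\<eta> \<le> 1" "0 \<le> \<eta>'" "\<eta>' \<le> 1"
    and "valid_jobs J1" "valid_jobs J2" "bij_betw \<pi> J1 J2"
    and "\<forall>x\<in>J1. \<bar>rel x - rel (\<pi> x)\<bar> \<le> \<eta>' \<and> proc x \<le> proc (\<pi> x) * (1 + \<eta>) \<and> wt x \<le> wt (\<pi> x) * (1 + \<eta>)"
  shows "OPT \<alpha> F J1 \<le> (1 + \<beta> J1 * \<eta>) * OPT \<alpha> F J2 + \<beta> J1 * real (card J1) * \<eta>'"
  using assms unfolding beta_smooth_def by blast

lemma beta_smooth_F_le:
  assumes "beta_smooth \<alpha> F \<beta>" and "0 \<le> \<eta>'" "\<eta>' \<le> 1"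
    and "valid_jobs J1" "valid_jobs J2" "bij_betw \<pi> J1 J2"
    and "feasible \<alpha> J1 S1" "feasible \<alpha> J2 S2"
    and "\<forall>x\<in>J1. proc x \<le> proc (\<pi> x) \<and> wt x \<le> wt (\<pi> x) \<and> rel (\<pi> x) - \<eta>' \<le> rel x \<and>
           (\<forall>t. rel (\<pi> x) + \<eta>' \<le> t \<longrightarrow> work S1 x t \<le> work S2 (\<pi> x) (t - \<eta>'))"
  shows "F S1 J1 \<le> F S2 J2 + \<beta> J1 * real (card J1) * \<eta>'"
proof -
  have "\<forall>S1 S2. feasible \<alpha> J1 S1 \<longrightarrow> feasible \<alpha> J2 S2 \<longrightarrow>
      (\<forall>x\<in>J1. proc x \<le> proc (\<pi> x) \<and> wt x \<le> wt (\<pi> x) \<and> rel x \<ge> rel (\<pi> x) - \<eta>' \<and>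
         (\<forall>t. t \<ge> rel (\<pi> x) + \<eta>' \<longrightarrow> work S1 x t \<le> work S2 (\<pi> x) (t - \<eta>'))) \<longrightarrow>
      F S1 J1 \<le> F S2 J2 + \<beta> J1 * real (card J1) * \<eta>'"
    using assms(1-6) unfolding beta_smooth_def by (metis order.refl zero_le_one)
  then show ?thesis using assms(7-9) by blast
qed

lemma beta_smooth_mono:
  assumes "beta_smooth \<alpha> F \<beta>" and "valid_jobs J" and "K \<subseteq> J"
  shows "\<beta> K \<le> \<beta> J"
  using assms unfolding beta_smooth_def monotone_fun_def by blast

lemma quality_cost_subset_le:
  assumes "quality_cost \<alpha> F" and "valid_jobs J" and "K \<subseteq> J" and "feasible \<alpha> J S"
  shows "F S K \<le> F S J"
  using assms unfolding quality_cost_def by blast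

lemma beta_smooth_F_le_same_speed:
  assumes "beta_smooth \<alpha> F \<beta>" and "valid_jobs J1" "valid_jobs J2" "bij_betw \<pi> J1 J2"
    and "feasible \<alpha> J1 S1" "feasible \<alpha> J2 S2"
    and same: "\<forall>x\<in>J1. jid (\<pi> x) = jid x \<and> rel (\<pi> x) = rel x \<and> proc x \<le> proc (\<pi> x) \<and> wt x \<le> wt (\<pi> x) \<and>
                     (\<forall>t>rel x. S1 (jid x) t = S2 (jid x) t)"
  shows "F S1 J1 \<le> F S2 J2"
proof -
  have "work S1 x t \<le> work S2 (\<pi> x) t" if "x \<in> J1" "rel x \<le> t" for x t
  proof -
    have "(LBINT u=ereal (rel x)..ereal t. S1 (jid x) u) = (LBINT u=ereal (rel x)..ereal t. S2 (jid x) u)"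
      using same that by (intro interval_integral_cong) (auto simp: einterval_iff)
    then show ?thesis using same that(1) by (simp add: work_def)
  qed
  then show ?thesis
    using beta_smooth_F_le[OF assms(1) order.refl zero_le_one assms(2-6)] same by simp
qed

context
  fixes \<alpha> :: real and F :: "'i schedule \<Rightarrow> 'i job set \<Rightarrow> real" and \<beta> :: "'i job set \<Rightarrow> real"
    and K :: "'i job set" and Sh :: "'i schedule"
  assumes smooth: "beta_smooth \<alpha> F \<beta>" and \<alpha>: "0 \<le> \<alpha>"
    and valid: "valid_jobs K" and feasible: "feasible \<alpha> K Sh"
begin

lemma feasible_delay_perturb:
  assumes release: "\<forall>x\<in>K. 0 \<le> \<rho> (jid x) \<and> \<rho> (jid x) \<le> rel x + c"
  shows "feasible \<alpha> (perturb \<rho> (\<lambda>_. 0) K) (delay c Sh)"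
proof (rule feasible_dominated[OF feasible valid _ _ \<alpha>])
  show "valid_jobs (perturb \<rho> (\<lambda>_. 0) K)"
    using valid release by (intro valid_jobs_perturb) auto
  show "\<forall>y\<in>perturb \<rho> (\<lambda>_. 0) K. delay c Sh (jid y) \<in> borel_measurable lborel"
  proof
    fix y assume "y \<in> perturb \<rho> (\<lambda>_. 0) K"
    then obtain x where "x \<in> K" "jid y = jid x" by (auto simp: perturb_def)
    then have [measurable]: "Sh (jid y) \<in> borel_measurable borel"
      using feasible_speed_measurable[OF feasible] by metis
    show "delay c Sh (jid y) \<in> borel_measurable lborel"
      unfolding delay_def by measurable
  qed
  show "\<forall>y\<in>perturb \<rho> (\<lambda>_. 0) K. \<forall>t. 0 \<le> delay c Sh (jid y) t \<and> delay c Sh (jid y) t \<le> delay c Sh (jid y) t"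
    using feasible_speed_nonneg[OF feasible] by (auto simp: perturb_def delay_def)
  show "\<forall>y\<in>perturb \<rho> (\<lambda>_. 0) K. \<forall>t. t < rel y \<longrightarrow> delay c Sh (jid y) t = 0"
  proof (intro ballI allI impI)
    fix y t assume "y \<in> perturb \<rho> (\<lambda>_. 0) K" and "t < rel y"
    then obtain x where "x \<in> K" "jid y = jid x" "t - c < rel x"
      using release unfolding perturb_def by fastforce
    then show "delay c Sh (jid y) t = 0"
      using feasible_speed_before_release[OF feasible] by (simp add: delay_def)
  qed
qed (simp_all add: valid)

lemma F_delay_step:
  assumes "0 \<le> \<delta>" "\<delta> \<le> 1"
    and release: "\<forall>x\<in>K. 0 \<le> \<sigma> (jid x) \<and> \<sigma> (jid x) \<le> rel x + c \<and>
                        0 \<le> \<rho> (jid x) \<and> \<rho> (jid x) \<le> rel x + c + \<delta> \<and> \<sigma> (jid x) - \<delta> \<le> \<rho> (jid x)"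
  shows "F (delay (c + \<delta>) Sh) (perturb \<rho> (\<lambda>_. 0) K)
         \<le> F (delay c Sh) (perturb \<sigma> (\<lambda>_. 0) K) + \<beta> K * real (card K) * \<delta>"
proof -
  define P where "P = perturb \<rho> (\<lambda>_. 0) K"
  define Q where "Q = perturb \<sigma> (\<lambda>_. 0) K"
  define \<pi> where "\<pi> y = (jid y, \<sigma> (jid y), proc y, wt y)" for y :: "'i job"
  have inj: "inj_on jid K" using valid by (simp add: valid_jobs_def)
  have bij: "bij_betw \<pi> P Q"
    using inj by (auto simp: bij_betw_def inj_on_def P_def Q_def perturb_def \<pi>_def image_image)
  have "valid_jobs P" "valid_jobs Q"
    using valid release by (auto simp: P_def Q_def intro!: valid_jobs_perturb)
  moreover have "feasible \<alpha> P (delay (c + \<delta>) Sh)" "feasible \<alpha> Q (delay c Sh)"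
    using release by (auto simp: P_def Q_def intro!: feasible_delay_perturb)
  moreover have "\<forall>y\<in>P. proc y \<le> proc (\<pi> y) \<and> wt y \<le> wt (\<pi> y) \<and> rel (\<pi> y) - \<delta> \<le> rel y \<and>
      (\<forall>t. rel (\<pi> y) + \<delta> \<le> t \<longrightarrow> work (delay (c + \<delta>) Sh) y t \<le> work (delay c Sh) (\<pi> y) (t - \<delta>))"
  proof
    fix y assume "y \<in> P"
    then obtain x where x: "x \<in> K" "y = (jid x, \<rho> (jid x), proc x, wt x)"
      unfolding P_def perturb_def by auto
    have vanish: "\<And>u. u < rel x \<Longrightarrow> Sh (jid x) u = 0"
      using feasible_speed_before_release[OF feasible x(1)] .
    have A: "work (delay (c + \<delta>) Sh) y t = proc x - (LBINT u=ereal (rel x)..ereal (t - (c + \<delta>)). Sh (jid x) u)" for t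
      unfolding x(2) by (rule work_delay[of "rel x" Sh "jid x", OF vanish]) (use release x(1) in auto)
    have B: "work (delay c Sh) (\<pi> y) (t - \<delta>) = proc x - (LBINT u=ereal (rel x)..ereal (t - \<delta> - c). Sh (jid x) u)" for t
      unfolding x(2) \<pi>_def
      by (simp only: job_simps, rule work_delay[of "rel x" Sh "jid x", OF vanish]) (use release x(1) in auto)
    show "proc y \<le> proc (\<pi> y) \<and> wt y \<le> wt (\<pi> y) \<and> rel (\<pi> y) - \<delta> \<le> rel y \<and>
      (\<forall>t. rel (\<pi> y) + \<delta> \<le> t \<longrightarrow> work (delay (c + \<delta>) Sh) y t \<le> work (delay c Sh) (\<pi> y) (t - \<delta>))"
      unfolding A B using release x by (simp add: \<pi>_def algebra_simps)
  qed
  ultimately have "F (delay (c + \<delta>) Sh) P \<le> F (delay c Sh) Q + \<beta> P * real (card P) * \<delta>"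
    by (intro beta_smooth_F_le[OF smooth assms(1,2) _ _ bij])
  also have "\<beta> P * real (card P) * \<delta> \<le> \<beta> K * real (card K) * \<delta>"
  proof -
    have "\<beta> P \<le> \<beta> K"
      using smooth valid release by (auto simp: P_def beta_smooth_def intro!: beta_perturb_release_le)
    then show ?thesis using \<open>0 \<le> \<delta>\<close> by (simp add: P_def card_perturb[OF inj] mult_right_mono)
  qed
  finally show ?thesis by (simp add: P_def Q_def)
qed

text \<open>Clause (ii) of \<open>\<beta>\<close>-smoothness only tolerates delays up to 1, so a delay \<open>c\<close> is
  reached in \<open>n > c\<close> steps of length \<open>c / n\<close>, moving the release times linearly from those
  of \<open>K\<close> to \<open>\<rho>\<close>.\<close>

lemma F_delay_le:
  assumes "0 \<le> c" and release: "\<forall>x\<in>K. 0 \<le> \<rho> (jid x) \<and> \<bar>\<rho> (jid x) - rel x\<bar> \<le> c"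
  shows "F (delay c Sh) (perturb \<rho> (\<lambda>_. 0) K) \<le> F Sh K + \<beta> K * real (card K) * c"
proof -
  define n where "n = Suc (nat \<lceil>c\<rceil>)"
  define \<delta> where "\<delta> = c / n"
  define r where "r i = rel (job_with_id K i)" for i
  define \<rho>' where "\<rho>' k i = r i + real k / n * (\<rho> i - r i)" for k :: nat and i
  have inj: "inj_on jid K" using valid by (simp add: valid_jobs_def)
  have r: "r (jid x) = rel x" if "x \<in> K" for x
    using job_with_id_eq[OF inj that] by (simp add: r_def)
  have "c \<le> n" unfolding n_def using \<open>0 \<le> c\<close> by linarith
  then have \<delta>: "0 \<le> \<delta>" "\<delta> \<le> 1" using \<open>0 \<le> c\<close> by (auto simp: \<delta>_def divide_le_eq)
  have "0 < n" by (simp add: n_def)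
  have release_k: "0 \<le> \<rho>' k (jid x) \<and> \<rho>' k (jid x) \<le> rel x + real k * \<delta>" if "x \<in> K" "k \<le> n" for x k
    using interpolation_bounds(1,2)[where a = "rel x" and b = "\<rho> (jid x)" and c = c and k = k and n = n]
      release valid that \<open>0 < n\<close>
    by (simp add: \<rho>'_def r \<delta>_def valid_jobs_def)
  have step_k: "\<rho>' k (jid x) - \<delta> \<le> \<rho>' (Suc k) (jid x)" if "x \<in> K" for x k
    using interpolation_bounds(3)[where a = "rel x" and b = "\<rho> (jid x)" and c = c and k = k and n = n]
      release valid that \<open>0 < n\<close>
    by (simp add: \<rho>'_def r \<delta>_def valid_jobs_def)
  have "F (delay (real k * \<delta>) Sh) (perturb (\<rho>' k) (\<lambda>_. 0) K)
      \<le> F Sh K + \<beta> K * real (card K) * (real k * \<delta>)" if "k \<le> n" for k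
    using that
  proof (induction k)
    case 0
    have "\<rho>' 0 = (\<lambda>i. rel (job_with_id K i))" by (simp add: fun_eq_iff \<rho>'_def r_def)
    then have "perturb (\<rho>' 0) (\<lambda>_. 0) K = K" using perturb_release_self[OF inj] by simp
    then show ?case by (simp add: delay_def)
  next
    case (Suc k)
    have "F (delay (real k * \<delta> + \<delta>) Sh) (perturb (\<rho>' (Suc k)) (\<lambda>_. 0) K)
        \<le> F (delay (real k * \<delta>) Sh) (perturb (\<rho>' k) (\<lambda>_. 0) K) + \<beta> K * real (card K) * \<delta>"
      using release_k[of _ k] release_k[of _ "Suc k"] step_k Suc.prems
      by (intro F_delay_step \<delta>) (auto simp: algebra_simps)
    then show ?case using Suc by (simp add: algebra_simps)
  qed
  moreover have "\<rho>' n = \<rho>" "real n * \<delta> = c"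
    by (simp_all add: \<rho>'_def \<delta>_def fun_eq_iff n_def)
  ultimately show ?thesis by (metis order.refl)
qed

end

lemma
  fixes Sh :: "'i schedule"
  assumes feasibleU: "feasible \<alpha> JU Sh" and validU: "valid_jobs JU" and valid: "valid_jobs J"
    and \<alpha>: "0 \<le> \<alpha>" and partner: "\<forall>z\<in>J. \<exists>u\<in>JU. jid u = jid z \<and> rel z \<le> rel u + c"
  shows feasible_truncated_delay: "feasible \<alpha> J (\<lambda>j t. if tlam \<le> t then Sh j (t - c) else 0)"
    and energy_truncated_delay_le:
      "energy \<alpha> (\<lambda>j t. if tlam \<le> t then Sh j (t - c) else 0) J \<le> energy \<alpha> Sh JU"
proof -
  define S where "S = (\<lambda>j t. if tlam \<le> t then Sh j (t - c) else (0::real))"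
  have ids: "jid ` J \<subseteq> jid ` JU" using partner by force
  have measurable: "\<forall>z\<in>J. S (jid z) \<in> borel_measurable lborel"
  proof
    fix z assume "z \<in> J"
    then obtain u where "u \<in> JU" "jid u = jid z" using partner by blast
    then have [measurable]: "Sh (jid z) \<in> borel_measurable borel"
      using feasible_speed_measurable[OF feasibleU] by metis
    show "S (jid z) \<in> borel_measurable lborel" unfolding S_def by measurable
  qed
  have dominated: "\<forall>z\<in>J. \<forall>t. 0 \<le> S (jid z) t \<and> S (jid z) t \<le> delay c Sh (jid z) t"
  proof (intro ballI allI)
    fix z t assume "z \<in> J"
    then obtain u where "u \<in> JU" "jid u = jid z" using partner by blast
    then show "0 \<le> S (jid z) t \<and> S (jid z) t \<le> delay c Sh (jid z) t"
      using feasible_speed_nonneg[OF feasibleU, of u] by (simp add: S_def delay_def)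
  qed
  have "\<forall>z\<in>J. \<forall>t<rel z. S (jid z) t = 0"
  proof (intro ballI allI impI)
    fix z t assume "z \<in> J" "t < rel z"
    moreover obtain u where "u \<in> JU" "jid u = jid z" "rel z \<le> rel u + c"
      using partner \<open>z \<in> J\<close> by blast
    ultimately show "S (jid z) t = 0"
      using feasible_speed_before_release[OF feasibleU, of u "t - c"] by (simp add: S_def)
  qed
  then show "feasible \<alpha> J (\<lambda>j t. if tlam \<le> t then Sh j (t - c) else 0)"
    unfolding S_def[symmetric]
    by (rule feasible_dominated[OF feasibleU validU valid ids \<alpha> measurable dominated])
  show "energy \<alpha> (\<lambda>j t. if tlam \<le> t then Sh j (t - c) else 0) J \<le> energy \<alpha> Sh JU"
    unfolding S_def[symmetric]
    by (rule energy_le_dominated[OF feasibleU validU valid ids \<alpha> measurable dominated])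
qed

text \<open>The comparison goes through \<open>K\<close>, the partners in \<open>JU\<close> of the jobs of \<open>J\<close>, moved to
  the release times \<open>\<rho>\<close> of their jobs.\<close>

lemma F_truncated_delay_le:
  assumes smooth: "beta_smooth \<alpha> F \<beta>" and quality: "quality_cost \<alpha> F" and \<alpha>: "0 \<le> \<alpha>"
    and validU: "valid_jobs JU" and feasibleU: "feasible \<alpha> JU Sh"
    and valid: "valid_jobs J" and "0 \<le> c"
    and close: "\<forall>z\<in>J. tlam \<le> rel z \<and>
       (\<exists>u\<in>JU. jid u = jid z \<and> \<bar>rel z - rel u\<bar> \<le> c \<and> proc z \<le> proc u \<and> wt z \<le> wt u)"
  shows "F (\<lambda>j t. if tlam \<le> t then Sh j (t - c) else 0) J \<le> F Sh JU + \<beta> JU * real (card J) * c"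
proof -
  define S where "S = (\<lambda>j t. if tlam \<le> t then Sh j (t - c) else (0::real))"
  define u where "u z = job_with_id JU (jid z)" for z
  define K where "K = u ` J"
  define \<rho> where "\<rho> i = rel (job_with_id J i)" for i
  have inj: "inj_on jid J" "inj_on jid JU" using valid validU by (simp_all add: valid_jobs_def)
  have u: "u z \<in> JU \<and> jid (u z) = jid z \<and> \<bar>rel z - rel (u z)\<bar> \<le> c \<and> proc z \<le> proc (u z) \<and>
      wt z \<le> wt (u z) \<and> tlam \<le> rel z" if z: "z \<in> J" for z
  proof -
    have "\<exists>y\<in>JU. jid y = jid z \<and> (\<bar>rel z - rel y\<bar> \<le> c \<and> proc z \<le> proc y \<and> wt z \<le> wt y)"
      using close z by blast
    from job_with_id_partner[OF inj(2) this] show ?thesis using close z by (simp add: u_def)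
  qed
  have \<rho>: "\<rho> (jid z) = rel z" if "z \<in> J" for z
    using job_with_id_eq[OF inj(1) that] by (simp add: \<rho>_def)
  have "K \<subseteq> JU" using u unfolding K_def by blast
  then have validK: "valid_jobs K" and feasibleK: "feasible \<alpha> K Sh"
    using valid_jobs_subset[OF validU] feasible_subset[OF feasibleU validU _ \<alpha>] by simp_all
  have "inj_on u J" using u inj_onD[OF inj(1)] by (metis inj_onI)
  then have cardK: "card K = card J" by (simp add: K_def card_image)
  have release: "\<forall>x\<in>K. 0 \<le> \<rho> (jid x) \<and> \<bar>\<rho> (jid x) - rel x\<bar> \<le> c"
    using u \<rho> valid by (auto simp: K_def valid_jobs_def abs_minus_commute)
  define \<pi> where "\<pi> z = (jid z, rel z, proc (u z), wt (u z))" for z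
  have "\<pi> ` J = perturb \<rho> (\<lambda>_. 0) K"
    unfolding perturb_def K_def image_image using u \<rho> by (auto simp: \<pi>_def intro!: image_cong)
  moreover have "inj_on \<pi> J" using inj(1) by (auto simp: \<pi>_def inj_on_def)
  ultimately have bij: "bij_betw \<pi> J (perturb \<rho> (\<lambda>_. 0) K)" by (simp add: bij_betw_def)
  have "F S J \<le> F (delay c Sh) (perturb \<rho> (\<lambda>_. 0) K)"
  proof (rule beta_smooth_F_le_same_speed[OF smooth valid _ bij])
    show "feasible \<alpha> J S"
      unfolding S_def using u by (intro feasible_truncated_delay[OF feasibleU validU valid \<alpha>]) force
    show "valid_jobs (perturb \<rho> (\<lambda>_. 0) K)"
      using release by (intro valid_jobs_perturb[OF validK]) auto
    show "feasible \<alpha> (perturb \<rho> (\<lambda>_. 0) K) (delay c Sh)"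
      using release by (intro feasible_delay_perturb[OF smooth \<alpha> validK feasibleK]) auto
    show "\<forall>z\<in>J. jid (\<pi> z) = jid z \<and> rel (\<pi> z) = rel z \<and> proc z \<le> proc (\<pi> z) \<and> wt z \<le> wt (\<pi> z) \<and>
        (\<forall>t>rel z. S (jid z) t = delay c Sh (jid z) t)"
    proof (intro ballI conjI allI impI)
      fix z t assume "z \<in> J" and "rel z < t"
      then have "tlam \<le> t" using u[of z] by simp
      then show "S (jid z) t = delay c Sh (jid z) t" by (simp add: S_def delay_def)
    qed (use u in \<open>auto simp: \<pi>_def\<close>)
  qed
  also have "\<dots> \<le> F Sh K + \<beta> K * real (card K) * c"
    by (rule F_delay_le[OF smooth \<alpha> validK feasibleK \<open>0 \<le> c\<close> release])
  also have "\<dots> \<le> F Sh JU + \<beta> JU * real (card J) * c"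
  proof (intro add_mono mult_right_mono)
    show "F Sh K \<le> F Sh JU"
      by (rule quality_cost_subset_le[OF quality validU \<open>K \<subseteq> JU\<close> feasibleU])
    show "\<beta> K * real (card K) \<le> \<beta> JU * real (card J)"
      using beta_smooth_mono[OF smooth validU \<open>K \<subseteq> JU\<close>] by (simp add: cardK mult_right_mono)
  qed (use \<open>0 \<le> c\<close> in simp_all)
  finally show ?thesis by (simp add: S_def)
qed

lemma cost_truncated_delay_le:
  assumes "beta_smooth \<alpha> F \<beta>" and "quality_cost \<alpha> F" and "0 \<le> \<alpha>"
    and "valid_jobs JU" and "feasible \<alpha> JU Sh" and "valid_jobs J" and "0 \<le> c"
    and close: "\<forall>z\<in>J. tlam \<le> rel z \<and>
       (\<exists>u\<in>JU. jid u = jid z \<and> \<bar>rel z - rel u\<bar> \<le> c \<and> proc z \<le> proc u \<and> wt z \<le> wt u)"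
  shows "cost \<alpha> F (\<lambda>j t. if tlam \<le> t then Sh j (t - c) else 0) J
         \<le> cost \<alpha> F Sh JU + \<beta> JU * real (card J) * c"
proof -
  have "\<forall>z\<in>J. \<exists>u\<in>JU. jid u = jid z \<and> rel z \<le> rel u + c"
    using close by (fastforce simp: abs_le_iff)
  from energy_truncated_delay_le[OF assms(5,4,6,3) this, where tlam = tlam] F_truncated_delay_le[OF assms]
  show ?thesis unfolding cost_def by linarith
qed

lemma J_up_eq_perturb:
  assumes "inj_on jid Jh"
  shows "J_up \<beta> \<eta>s Jh = perturb (\<lambda>i. rel (job_with_id Jh i)) (\<lambda>_. \<eta>s / \<beta> Jh) Jh"
  unfolding J_up_def perturb_def by (rule image_cong) (simp_all add: job_with_id_eq[OF assms])

lemma valid_jobs_J_up: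
  assumes "valid_jobs Jh" and "0 \<le> \<eta>s / \<beta> Jh"
  shows "valid_jobs (J_up \<beta> \<eta>s Jh)"
proof -
  have inj: "inj_on jid Jh" using assms(1) by (simp add: valid_jobs_def)
  have "\<forall>x\<in>Jh. 0 \<le> rel (job_with_id Jh (jid x)) \<and> 0 \<le> \<eta>s / \<beta> Jh"
    using assms by (simp add: job_with_id_eq[OF inj] valid_jobs_def)
  then show ?thesis
    unfolding J_up_eq_perturb[OF inj] by (rule valid_jobs_perturb[OF assms(1)])
qed

lemma beta_J_up_le:
  assumes "smooth_fun \<beta>" and "valid_jobs Jh" and "Jh \<noteq> {}" and "0 \<le> \<eta>s / \<beta> Jh"
  shows "\<beta> (J_up \<beta> \<eta>s Jh) \<le> (1 + \<eta>s / \<beta> Jh) * \<beta> Jh"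
proof -
  have inj: "inj_on jid Jh" using assms(2) by (simp add: valid_jobs_def)
  have "(\<lambda>x. \<eta>s / \<beta> Jh) ` Jh = {\<eta>s / \<beta> Jh}" using assms(3) by auto
  moreover have "\<forall>x\<in>Jh. 0 \<le> rel (job_with_id Jh (jid x))"
    using assms(2) by (simp add: job_with_id_eq[OF inj] valid_jobs_def)
  ultimately show ?thesis
    using assms(1)[unfolded smooth_fun_def, rule_format,
        of Jh "\<lambda>i. rel (job_with_id Jh i)" "\<lambda>_. \<eta>s / \<beta> Jh"] assms(2-4)
    by (simp add: J_up_eq_perturb[OF inj])
qed

lemma OPT_J_up_le:
  fixes Jh :: "'i job set"
  assumes smooth: "beta_smooth \<alpha> F \<beta>" and valid: "valid_jobs Jh"
    and "0 \<le> \<eta>s / \<beta> Jh" "\<eta>s / \<beta> Jh \<le> 1"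
  shows "OPT \<alpha> F (J_up \<beta> \<eta>s Jh) \<le> (1 + \<beta> (J_up \<beta> \<eta>s Jh) * (\<eta>s / \<beta> Jh)) * OPT \<alpha> F Jh"
proof -
  define \<eta> where "\<eta> = \<eta>s / \<beta> Jh"
  define up where "up y = (jid y, rel y, proc y * (1 + \<eta>), wt y * (1 + \<eta>))" for y :: "'i job"
  have JU: "J_up \<beta> \<eta>s Jh = up ` Jh" by (simp add: J_up_def up_def \<eta>_def)
  define down where "down x = (jid x, rel x, proc x / (1 + \<eta>), wt x / (1 + \<eta>))" for x :: "'i job"
  have "0 \<le> \<eta>" using assms(3) by (simp add: \<eta>_def)
  then have "bij_betw down (up ` Jh) Jh"
    by (intro bij_betw_byWitness[where f' = up]) (auto simp: up_def down_def)
  moreover have "\<forall>x\<in>up ` Jh. \<bar>rel x - rel (down x)\<bar> \<le> 0 \<and>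
      proc x \<le> proc (down x) * (1 + \<eta>) \<and> wt x \<le> wt (down x) * (1 + \<eta>)"
    using \<open>0 \<le> \<eta>\<close> by (auto simp: up_def down_def)
  ultimately show ?thesis
    using beta_smooth_OPT_le[OF smooth assms(3,4)[folded \<eta>_def] order.refl zero_le_one
        valid_jobs_J_up[of Jh \<eta>s \<beta>, OF valid assms(3)] valid] unfolding JU \<eta>_def by simp
qed

lemma released_J_shift_close:
  "\<forall>z\<in>released_from tlam (J_shift \<alpha> F \<beta> \<eta>s J Jh). tlam \<le> rel z \<and>
     (\<exists>u\<in>J_up \<beta> \<eta>s Jh. jid u = jid z \<and> \<bar>rel z - rel u\<bar> \<le> eta_bar \<alpha> F \<beta> \<eta>s Jh \<and>
        proc z \<le> proc u \<and> wt z \<le> wt u)"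
proof
  fix z assume "z \<in> released_from tlam (J_shift \<alpha> F \<beta> \<eta>s J Jh)"
  then obtain y where "tlam \<le> rel z" "y \<in> Jh" "jid y = jid z" "\<bar>rel z - rel y\<bar> \<le> eta_bar \<alpha> F \<beta> \<eta>s Jh"
    "\<bar>proc z - proc y\<bar> \<le> \<eta>s / \<beta> Jh * proc y" "\<bar>wt z - wt y\<bar> \<le> \<eta>s / \<beta> Jh * wt y"
    by (auto simp: released_from_def J_shift_def)
  then show "tlam \<le> rel z \<and> (\<exists>u\<in>J_up \<beta> \<eta>s Jh. jid u = jid z \<and>
      \<bar>rel z - rel u\<bar> \<le> eta_bar \<alpha> F \<beta> \<eta>s Jh \<and> proc z \<le> proc u \<and> wt z \<le> wt u)"
    unfolding J_up_def by (intro conjI bexI[OF _ imageI]) (auto simp: abs_le_iff algebra_simps)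
qed

lemma valid_jobs_released_J_shift:
  "valid_jobs J \<Longrightarrow> valid_jobs (released_from t (J_shift \<alpha> F \<beta> \<eta>s J Jh))"
  by (erule valid_jobs_subset) (auto simp: released_from_def J_shift_def)

lemma card_released_J_shift_le:
  assumes "valid_jobs J" and "finite Jh"
  shows "card (released_from t (J_shift \<alpha> F \<beta> \<eta>s J Jh)) \<le> card Jh"
proof -
  let ?Js = "released_from t (J_shift \<alpha> F \<beta> \<eta>s J Jh)"
  have "inj_on jid ?Js"
    using valid_jobs_released_J_shift[OF assms(1)] by (simp add: valid_jobs_def)
  then have "card ?Js = card (jid ` ?Js)" by (simp add: card_image)
  also have "\<dots> \<le> card (jid ` Jh)"
    using assms(2) unfolding released_from_def J_shift_def
    by (intro card_mono) (auto intro: rev_image_eqI)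
  also have "\<dots> \<le> card Jh" by (rule card_image_le[OF assms(2)])
  finally show ?thesis .
qed

lemma OPT_J_up_shift_le:
  assumes smooth: "beta_smooth \<alpha> F \<beta>" and valid: "valid_jobs Jh" and "Jh \<noteq> {}"
    and opt: "0 < OPT \<alpha> F Jh" and "0 \<le> \<eta>s" "\<eta>s < 1" and "m \<le> card Jh"
  shows "OPT \<alpha> F (J_up \<beta> \<eta>s Jh) + \<beta> (J_up \<beta> \<eta>s Jh) * real m * eta_bar \<alpha> F \<beta> \<eta>s Jh
         \<le> (1 + 2 * \<eta>s * (1 + \<eta>s)) * OPT \<alpha> F Jh"
proof -
  define \<eta> where "\<eta> = \<eta>s / \<beta> Jh"
  define opt where "opt = OPT \<alpha> F Jh"
  let ?B = "\<beta> (J_up \<beta> \<eta>s Jh)"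
  have "1 \<le> \<beta> Jh" using beta_smooth_ge_1[OF smooth valid] .
  then have \<eta>: "0 \<le> \<eta>" "\<eta> \<le> \<eta>s"
    using \<open>0 \<le> \<eta>s\<close> mult_left_mono[of 1 "\<beta> Jh" \<eta>s] by (auto simp: \<eta>_def divide_le_eq)
  have "0 < real (card Jh)" using valid \<open>Jh \<noteq> {}\<close> by (simp add: valid_jobs_def card_gt_0_iff)
  then have "real m / card Jh \<le> 1" using \<open>m \<le> card Jh\<close> by simp
  moreover have "eta_bar \<alpha> F \<beta> \<eta>s Jh = \<eta> * opt / card Jh" by (simp add: eta_bar_def \<eta>_def opt_def)
  ultimately have "real m * eta_bar \<alpha> F \<beta> \<eta>s Jh \<le> \<eta> * opt"
    using mult_left_le_one_le[of "\<eta> * opt" "m / card Jh"] \<eta> opt by (simp add: opt_def)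
  moreover have "0 \<le> ?B"
    using beta_smooth_ge_1[OF smooth valid_jobs_J_up[of Jh \<eta>s \<beta>, OF valid]] \<eta>
    by (simp add: \<eta>_def)
  ultimately have shift: "?B * real m * eta_bar \<alpha> F \<beta> \<eta>s Jh \<le> ?B * \<eta> * opt"
    by (metis mult.assoc mult_left_mono)
  have up: "OPT \<alpha> F (J_up \<beta> \<eta>s Jh) \<le> (1 + ?B * \<eta>) * opt"
    using OPT_J_up_le[OF smooth valid] \<eta> \<open>\<eta>s < 1\<close> by (simp add: \<eta>_def opt_def)
  have "?B * \<eta> \<le> (1 + \<eta>s) * \<eta>s"
  proof -
    have "?B \<le> (1 + \<eta>) * \<beta> Jh"
      using beta_J_up_le[OF beta_smooth_imp_smooth_fun[OF smooth] valid \<open>Jh \<noteq> {}\<close>] \<eta>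
      by (simp add: \<eta>_def)
    then have "?B * \<eta> \<le> (1 + \<eta>) * \<beta> Jh * \<eta>"
      using \<eta>(1) by (rule mult_right_mono)
    also have "\<dots> = (1 + \<eta>) * \<eta>s" using \<open>1 \<le> \<beta> Jh\<close> by (simp add: \<eta>_def)
    also have "\<dots> \<le> (1 + \<eta>s) * \<eta>s" using \<eta> \<open>0 \<le> \<eta>s\<close> by (simp add: mult_right_mono)
    finally show ?thesis .
  qed
  have "(1 + ?B * \<eta>) * opt + ?B * \<eta> * opt = (1 + 2 * (?B * \<eta>)) * opt"
    by algebra
  then have "OPT \<alpha> F (J_up \<beta> \<eta>s Jh) + ?B * real m * eta_bar \<alpha> F \<beta> \<eta>s Jh \<le> (1 + 2 * (?B * \<eta>)) * opt"
    using add_mono[OF up shift] by linarith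
  also have "\<dots> \<le> (1 + 2 * ((1 + \<eta>s) * \<eta>s)) * opt"
    by (rule mult_right_mono) (use \<open>?B * \<eta> \<le> (1 + \<eta>s) * \<eta>s\<close> opt in \<open>simp_all add: opt_def\<close>)
  also have "\<dots> = (1 + 2 * \<eta>s * (1 + \<eta>s)) * OPT \<alpha> F Jh"
    by (simp add: opt_def algebra_simps)
  finally show ?thesis .
qed

theorem lemma7:
  fixes \<alpha> :: real and F :: "'i schedule \<Rightarrow> 'i job set \<Rightarrow> real" and \<beta> :: "'i job set \<Rightarrow> real"
    and J Jh :: "'i job set" and \<eta>s tlam :: real and Sh :: "'i schedule"
  assumes "\<alpha> > 1"
    and "quality_cost \<alpha> F"
    and "beta_smooth \<alpha> F \<beta>"
    and "valid_jobs J" and "valid_jobs Jh" and "Jh \<noteq> {}" and "OPT \<alpha> F Jh > 0"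
    and "0 \<le> \<eta>s" and "\<eta>s < 1" and "0 \<le> tlam"
    and "feasible \<alpha> (J_up \<beta> \<eta>s Jh) Sh"
    and "cost \<alpha> F Sh (J_up \<beta> \<eta>s Jh) = OPT \<alpha> F (J_up \<beta> \<eta>s Jh)"
  shows "cost \<alpha> F (\<lambda>j t. if t \<ge> tlam then Sh j (t - eta_bar \<alpha> F \<beta> \<eta>s Jh) else 0)
             (released_from tlam (J_shift \<alpha> F \<beta> \<eta>s J Jh))
         \<le> (1 + 2 * \<eta>s * (1 + \<eta>s)) * OPT \<alpha> F Jh"
proof -
  let ?eb = "eta_bar \<alpha> F \<beta> \<eta>s Jh"
  let ?Js = "released_from tlam (J_shift \<alpha> F \<beta> \<eta>s J Jh)"
  have "1 \<le> \<beta> Jh" using beta_smooth_ge_1 assms(3,5) .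
  then have nonneg: "0 \<le> \<eta>s / \<beta> Jh" "0 \<le> ?eb"
    unfolding eta_bar_def using assms(7,8) by (auto intro!: mult_nonneg_nonneg divide_nonneg_nonneg)
  have "cost \<alpha> F (\<lambda>j t. if t \<ge> tlam then Sh j (t - ?eb) else 0) ?Js
      \<le> cost \<alpha> F Sh (J_up \<beta> \<eta>s Jh) + \<beta> (J_up \<beta> \<eta>s Jh) * real (card ?Js) * ?eb"
    using assms(1) nonneg
    by (intro cost_truncated_delay_le[OF assms(3,2) _ valid_jobs_J_up[OF assms(5)] assms(11)
          valid_jobs_released_J_shift[OF assms(4)] _ released_J_shift_close]) simp_all
  also have "\<dots> \<le> (1 + 2 * \<eta>s * (1 + \<eta>s)) * OPT \<alpha> F Jh"
    unfolding assms(12) using assms(5) card_released_J_shift_le[OF assms(4)]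
    by (intro OPT_J_up_shift_le[OF assms(3,5,6,7,8,9)]) (simp add: valid_jobs_def)
  finally show ?thesis .
qed

end
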